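(* There exist $n\in\mathbb{N}$, $L>0$, a nonempty compact convex set $\mathcal{C}\subset\mathbb{R}^n$, an open convex set $\mathcal{D}\subset\mathbb{R}^n$ containing $\mathcal{C}$, a convex function $f\colon\mathcal{D}\to\mathbb{R}$ with $L$-Lipschitz-continuous gradient, and a point $x_0\in\mathcal{C}$ such that any sequence $(x_t)_{t\in\mathbb{N}}$ generated from $x_0$ by the Frank-Wolfe algorithm for minimizing $f$ over $\mathcal{C}$ using the closed-loop strategy (with this constant $L$) does not converge.
   Context: $\mathbb{R}^n$ is equipped with the Euclidean inner product $\langle\cdot,\cdot\rangle$ and norm $\|\cdot\|$, and $\mathbb{N}=\{0,1,2,\ldots\}$. A sequence $(x_t)_{t\in\mathbb{N}}$ is generated by the Frank-Wolfe algorithm for minimizing $f$ over $\mathcal{C}$ from $x_0\in\mathcal{C}$ if for all $t\in\mathbb{N}$ there exist $v_t\in\operatorname{arg\,min}_{v\in\mathcal{C}}\langle v,\nabla f(x_t)\rangle$ and $\gamma_t\in[0,1]$ such that $x_{t+1}=(1-\gamma_t)x_t+\gamma_tv_t$. No restriction is made on which minimizer $v_t$ is selected: "any sequence" ranges over all possible choices of the $v_t$. The algorithm uses the closed-loop strategy with constant $L$ if, for all $t\in\mathbb{N}$, $$\gamma_t=\min\left\{\frac{\langle x_t-v_t,\nabla f(x_t)\rangle}{L\|x_t-v_t\|^2},1\right\}.$$ If $v_t=x_t$, this quotient is undefined but $x_{t+1}=x_t$ whatever the value of $\gamma_t\in[0,1]$; so in that case $\gamma_t\in[0,1]$ is arbitrary.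 *)

theory Defs
  imports "HOL-Analysis.Analysis" "HOL-Library.Function_Algebras"
begin

text \<open>
  The dimension is existentially quantified in the theorem, so it cannot be a type. The space of
  dimension \<open>n\<close> is \<^term>\<open>topspace (Euclidean_space n)\<close>, the set of real sequences that vanish
  from index \<open>n\<close> on, with its library topology. The pointwise vector space structure on functions
  (addition comes from \<open>Function_Algebras\<close>) makes \<^const>\<open>convex\<close> and \<^const>\<open>convex_on\<close>
  available.
\<close>

instantiation "fun" :: (type, real_vector) real_vector
begin

definition scaleR_fun :: "real \<Rightarrow> ('a \<Rightarrow> 'b) \<Rightarrow> 'a \<Rightarrow> 'b" where
  "scaleR_fun c x = (\<lambda>i. c *\<^sub>R x i)"

instance
  by standard (simp_all add: scaleR_fun_def fun_eq_iff algebra_simps)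

end

definition euclid_inner :: "nat \<Rightarrow> (nat \<Rightarrow> real) \<Rightarrow> (nat \<Rightarrow> real) \<Rightarrow> real" where
  "euclid_inner n x y = (\<Sum>i<n. x i * y i)"

definition euclid_norm :: "nat \<Rightarrow> (nat \<Rightarrow> real) \<Rightarrow> real" where
  "euclid_norm n x = L2_set x {..<n}"

text \<open>
  Frechet differentiability of \<open>f\<close> at \<open>x\<close> with gradient \<open>g\<close>. The filter \<^const>\<open>atin\<close> only sees
  points near \<open>x\<close>, so if \<open>x\<close> lies in an open set \<open>D\<close>, the values of \<open>f\<close> outside \<open>D\<close> do not matter.
\<close>

definition has_gradient ::
  "nat \<Rightarrow> ((nat \<Rightarrow> real) \<Rightarrow> real) \<Rightarrow> (nat \<Rightarrow> real) \<Rightarrow> (nat \<Rightarrow> real) \<Rightarrow> bool" where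
  "has_gradient n f g x \<longleftrightarrow>
     x \<in> topspace (Euclidean_space n) \<and> g \<in> topspace (Euclidean_space n) \<and>
     ((\<lambda>y. (f y - f x - euclid_inner n g (y - x)) / euclid_norm n (y - x)) \<longlongrightarrow> 0)
       (atin (Euclidean_space n) x)"

definition lipschitz_gradient_on ::
  "nat \<Rightarrow> real \<Rightarrow> (nat \<Rightarrow> real) set \<Rightarrow> ((nat \<Rightarrow> real) \<Rightarrow> real) \<Rightarrow>
   ((nat \<Rightarrow> real) \<Rightarrow> nat \<Rightarrow> real) \<Rightarrow> bool" where
  "lipschitz_gradient_on n L D f f' \<longleftrightarrow>
     (\<forall>x\<in>D. has_gradient n f (f' x) x) \<and>
     (\<forall>x\<in>D. \<forall>y\<in>D. euclid_norm n (f' x - f' y) \<le> L * euclid_norm n (x - y))"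

definition frank_wolfe ::
  "nat \<Rightarrow> (nat \<Rightarrow> real) set \<Rightarrow> ((nat \<Rightarrow> real) \<Rightarrow> nat \<Rightarrow> real) \<Rightarrow> (nat \<Rightarrow> real) \<Rightarrow>
   (nat \<Rightarrow> nat \<Rightarrow> real) \<Rightarrow> (nat \<Rightarrow> nat \<Rightarrow> real) \<Rightarrow> (nat \<Rightarrow> real) \<Rightarrow> bool" where
  "frank_wolfe n C f' x0 x v \<gamma> \<longleftrightarrow>
     x 0 = x0 \<and>
     (\<forall>t. is_arg_min (\<lambda>w. euclid_inner n w (f' (x t))) (\<lambda>w. w \<in> C) (v t) \<and>
          \<gamma> t \<in> {0..1} \<and>
          x (Suc t) = (1 - \<gamma> t) *\<^sub>R x t + \<gamma> t *\<^sub>R v t)"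

definition closed_loop ::
  "nat \<Rightarrow> real \<Rightarrow> ((nat \<Rightarrow> real) \<Rightarrow> nat \<Rightarrow> real) \<Rightarrow>
   (nat \<Rightarrow> nat \<Rightarrow> real) \<Rightarrow> (nat \<Rightarrow> nat \<Rightarrow> real) \<Rightarrow> (nat \<Rightarrow> real) \<Rightarrow> bool" where
  "closed_loop n L f' x v \<gamma> \<longleftrightarrow>
     (\<forall>t. v t \<noteq> x t \<longrightarrow>
        \<gamma> t = min (euclid_inner n (x t - v t) (f' (x t)) / (L * (euclid_norm n (x t - v t))\<^sup>2)) 1)"

end

theory Submission
  imports Defs
begin

text \<open>
  The counterexample lives in the plane, on the rectangle \<open>[-1, 1] \<times> [0, 1]\<close>. With \<open>r = 1/32\<close>, put
  \[f(a, b) = \sum_k \frac{r^k}{2} \max\Bigl\{0,\, b - r^k + \frac{(-1)^k r^k}{2} a\Bigr\}^2 .\]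
  It is convex and has a Lipschitz gradient because each summand is the square of the positive part
  of an affine function; on the rectangle its minimizers are the points of the bottom edge \<open>b = 0\<close>.

  The \<open>k\<close>-th summand vanishes once the height \<open>b\<close> is well below \<open>r^k\<close>, and among the summands
  still active at height \<open>b\<close> the first one dominates, by the factor \<open>r^2\<close> per index in the
  horizontal direction. Hence in the band \<open>3 r^(k+1) \<le> b \<le> r^k / 2\<close> the sign of the horizontal
  derivative is that of summand \<open>k + 1\<close>, namely \<open>(-1)^(k+1)\<close> (\<open>obj_a_sign\<close>). The vertical
  derivative is positive above the bottom edge. So the linear minimization oracle is forced: in this
  band it returns the bottom corner with abscissa \<open>-(-1)^(k+1)\<close>, and consecutive bands
  send the iterates to opposite corners.

  A step towards a bottom corner multiplies the height and the horizontal distance to that corner by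
  the same factor \<open>1 - \<gamma>\<close>. The ratio of the two is therefore constant while a band is crossed,
  whatever the step sizes are. Since the height drops by a large factor across the band, the
  iterate leaves it close to its corner (\<open>near_vertex_of_band\<close>). No control of the path
  between bands is needed. The closed-loop rule enters only twice. First, \<open>\<gamma> \<le> 1/4\<close>,
  because the gradient is \<open>O(b)\<close> and the constant \<open>16\<close> is large, so no band is jumped over. Second,
  \<open>\<gamma>\<close> stays away from \<open>0\<close> as long as the height does, so the height tends to \<open>0\<close> and every band is
  crossed (\<open>height_small\<close>). The abscissa is thus infinitely often within \<open>1/2\<close> of \<open>1\<close> and
  infinitely often within \<open>1/2\<close> of \<open>-1\<close>.
\<close>

section \<open>Geometrically weighted series\<close>

definition wsum :: "(nat \<Rightarrow> real) \<Rightarrow> real" where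
  "wsum c = (\<Sum>k. (1/32)^k * c k)"

lemma geom_sums: "(\<lambda>k. (1/32::real)^k * B) sums (32/31 * B)"
  using sums_mult2[OF geometric_sums[of "1/32::real"], of B] by simp

lemma summable_weighted:
  assumes "\<And>k. \<bar>c k\<bar> \<le> B"
  shows "summable (\<lambda>k. (1/32::real)^k * c k)"
proof (rule summable_comparison_test'[OF sums_summable[OF geom_sums]])
  show "norm ((1/32::real)^k * c k) \<le> (1/32)^k * B" if "k \<ge> 0" for k
    using assms[of k] by (simp add: abs_mult)
qed

lemma wsum_mono:
  assumes "\<And>k. \<bar>c k\<bar> \<le> B" "\<And>k. \<bar>d k\<bar> \<le> B'" "\<And>k. c k \<le> d k"
  shows "wsum c \<le> wsum d"
  unfolding wsum_def
  by (intro suminf_le summable_weighted[of c B] summable_weighted[of d B'])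
     (use assms in \<open>auto intro: mult_left_mono\<close>)

lemma wsum_abs_le:
  assumes "\<And>k. \<bar>c k\<bar> \<le> B"
  shows "\<bar>wsum c\<bar> \<le> 32/31 * B"
proof -
  have B: "B \<ge> 0" using assms[of 0] by linarith
  have const: "wsum (\<lambda>_. b) = 32/31 * b" for b
    unfolding wsum_def by (rule sums_unique[symmetric, OF geom_sums])
  have "c k \<le> B" "- B \<le> c k" for k using assms[of k] by (auto simp: abs_le_iff)
  then have "wsum c \<le> wsum (\<lambda>_. B)" "wsum (\<lambda>_. - B) \<le> wsum c"
    using B assms by (intro wsum_mono[of _ B _ B]; simp)+
  then show ?thesis by (simp add: const abs_le_iff)
qed

lemma wsum_add:
  assumes "\<And>k. \<bar>c k\<bar> \<le> B" "\<And>k. \<bar>d k\<bar> \<le> B'"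
  shows "wsum (\<lambda>k. c k + d k) = wsum c + wsum d"
  unfolding wsum_def
  using suminf_add[OF summable_weighted[OF assms(1)] summable_weighted[OF assms(2)]]
  by (simp add: algebra_simps)

lemma wsum_cmult:
  assumes "\<And>k. \<bar>c k\<bar> \<le> B"
  shows "wsum (\<lambda>k. c k * x) = wsum c * x"
  unfolding wsum_def
  using suminf_mult2[OF summable_weighted[OF assms], where c = x] by (simp add: algebra_simps)

lemma wsum_diff:
  assumes "\<And>k. \<bar>c k\<bar> \<le> B" "\<And>k. \<bar>d k\<bar> \<le> B'"
  shows "wsum (\<lambda>k. c k - d k) = wsum c - wsum d"
  unfolding wsum_def
  using suminf_diff[OF summable_weighted[OF assms(1)] summable_weighted[OF assms(2)]]
  by (simp add: algebra_simps)

section \<open>The objective in coordinates\<close>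

definition slope :: "nat \<Rightarrow> real" where
  "slope k = (-1)^k * (1/32)^k / 2"

definition ramp :: "nat \<Rightarrow> real \<Rightarrow> real \<Rightarrow> real" where
  "ramp k a b = max 0 (b - (1/32)^k + slope k * a)"

definition obj :: "real \<Rightarrow> real \<Rightarrow> real" where
  "obj a b = wsum (\<lambda>k. (ramp k a b)\<^sup>2 / 2)"

definition obj_a :: "real \<Rightarrow> real \<Rightarrow> real" where
  "obj_a a b = wsum (\<lambda>k. slope k * ramp k a b)"

definition obj_b :: "real \<Rightarrow> real \<Rightarrow> real" where
  "obj_b a b = wsum (\<lambda>k. ramp k a b)"

lemma pow_le_1: "(1/32::real)^k \<le> 1"
  by (simp add: power_le_one)

lemma abs_slope: "\<bar>slope k\<bar> = (1/32)^k / 2"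
  by (simp add: slope_def abs_mult power_abs)

lemma abs_slope_le: "\<bar>slope k\<bar> \<le> 1/2"
  using pow_le_1[of k] by (simp add: abs_slope)

lemma abs_slope_mult_le: "\<bar>slope k * x\<bar> \<le> \<bar>x\<bar> / 2"
  using mult_right_mono[OF abs_slope_le[of k], of "\<bar>x\<bar>"] by (simp add: abs_mult)

lemma ramp_nonneg: "0 \<le> ramp k a b"
  by (simp add: ramp_def)

lemma ramp_lipschitz: "\<bar>ramp k a b - ramp k a' b'\<bar> \<le> \<bar>a - a'\<bar> + \<bar>b - b'\<bar>"
proof -
  have "\<bar>slope k * a - slope k * a'\<bar> \<le> \<bar>a - a'\<bar> / 2"
    using abs_slope_mult_le[of k "a - a'"] by (simp only: right_diff_distrib)
  then show ?thesis unfolding ramp_def by argo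
qed

lemma ramp_le: "ramp k a b \<le> \<bar>a\<bar> + \<bar>b\<bar>"
  using ramp_lipschitz[of k a b 0 0] by (simp add: ramp_def)

lemma slope_ramp_le: "\<bar>slope k * ramp k a b\<bar> \<le> ramp k a b / 2"
  using abs_slope_mult_le[of k "ramp k a b"] ramp_nonneg[of k a b] by simp

lemma abs_ramp_le: "\<bar>ramp k a b\<bar> \<le> \<bar>a\<bar> + \<bar>b\<bar>"
  using ramp_le[of k a b] ramp_nonneg[of k a b] by simp

lemma abs_slope_ramp_le: "\<bar>slope k * ramp k a b\<bar> \<le> \<bar>a\<bar> + \<bar>b\<bar>"
  using slope_ramp_le[of k a b] ramp_le[of k a b] ramp_nonneg[of k a b] by linarith

lemma abs_ramp_sq_le: "\<bar>(ramp k a b)\<^sup>2 / 2\<bar> \<le> (\<bar>a\<bar> + \<bar>b\<bar>)\<^sup>2 / 2"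
  using power_mono[OF ramp_le ramp_nonneg, of k a b 2] by simp

text \<open>
  The Bregman remainder of \<open>s \<mapsto> (max 0 s)^2 / 2\<close> lies between \<open>0\<close> and half the square of the
  increment. Bounding it termwise yields convexity and the gradient of the whole series at once,
  without differentiating under the sum.
\<close>

lemma ramp_bregman:
  defines "R \<equiv> \<lambda>k a b a' b'. (ramp k a' b')\<^sup>2 / 2 - (ramp k a b)\<^sup>2 / 2
     - (slope k * ramp k a b * (a' - a) + ramp k a b * (b' - b))"
  shows "0 \<le> R k a b a' b'" "R k a b a' b' \<le> (a' - a)\<^sup>2 + (b' - b)\<^sup>2"
proof -
  define s where "s = b - (1/32)^k + slope k * a"
  define t where "t = b' - (1/32)^k + slope k * a'"
  have ts: "t - s = slope k * (a' - a) + (b' - b)"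
    by (simp add: s_def t_def algebra_simps)
  have R: "R k a b a' b' = (max 0 t)\<^sup>2 / 2 - (max 0 s)\<^sup>2 / 2 - max 0 s * (t - s)"
    unfolding R_def ts by (simp add: ramp_def s_def t_def algebra_simps)
  have pos: "max 0 s * t \<le> max 0 s * max 0 t" by (intro mult_left_mono) auto
  have sq: "max 0 s * s = (max 0 s)\<^sup>2" by (simp add: max_def power2_eq_square)
  have "0 \<le> (max 0 t - max 0 s)\<^sup>2" by simp
  then show "0 \<le> R k a b a' b'"
    unfolding R power2_diff right_diff_distrib sq using pos by argo
  have key: "R k a b a' b' \<le> (t - s)\<^sup>2 / 2"
  proof (cases "s \<ge> 0"; cases "t \<ge> 0")
    assume "s \<ge> 0" "\<not> t \<ge> 0"
    then show ?thesis unfolding R by (simp add: power2_eq_square algebra_simps)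
  next
    assume "\<not> s \<ge> 0" "t \<ge> 0"
    then have "t * t \<le> (t - s) * (t - s)" by (intro mult_mono) auto
    then show ?thesis using \<open>\<not> s \<ge> 0\<close> \<open>t \<ge> 0\<close> unfolding R by (simp add: power2_eq_square)
  qed (use zero_le_power2[of "t - s"] in \<open>simp_all add: R power2_eq_square algebra_simps\<close>)
  have "\<bar>t - s\<bar> \<le> \<bar>a' - a\<bar> + \<bar>b' - b\<bar>"
    unfolding ts
    by (rule order.trans[OF abs_triangle_ineq add_right_mono], rule order.trans[OF abs_slope_mult_le]) simp
  then have "(t - s)\<^sup>2 \<le> (\<bar>a' - a\<bar> + \<bar>b' - b\<bar>)\<^sup>2" by (metis abs_ge_zero power2_abs power_mono)
  also have "\<dots> \<le> 2 * ((a' - a)\<^sup>2 + (b' - b)\<^sup>2)"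
    using sum_squares_bound[of "\<bar>a' - a\<bar>" "\<bar>b' - b\<bar>"] by (simp add: power2_sum)
  finally have "(t - s)\<^sup>2 / 2 \<le> (a' - a)\<^sup>2 + (b' - b)\<^sup>2" by (simp only: mult.commute[of 2] divide_le_eq_numeral1)
  with key show "R k a b a' b' \<le> (a' - a)\<^sup>2 + (b' - b)\<^sup>2" by (rule order.trans)
qed

lemma obj_bregman:
  defines "R \<equiv> \<lambda>a b a' b'. obj a' b' - obj a b - (obj_a a b * (a' - a) + obj_b a b * (b' - b))"
  shows "0 \<le> R a b a' b'" "R a b a' b' \<le> 2 * ((a' - a)\<^sup>2 + (b' - b)\<^sup>2)"
proof -
  let ?r = "\<lambda>k. (ramp k a' b')\<^sup>2 / 2 - (ramp k a b)\<^sup>2 / 2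
     - (slope k * ramp k a b * (a' - a) + ramp k a b * (b' - b))"
  have b1: "\<bar>(ramp k a' b')\<^sup>2 / 2 - (ramp k a b)\<^sup>2 / 2\<bar> \<le> (\<bar>a'\<bar> + \<bar>b'\<bar>)\<^sup>2 / 2 + (\<bar>a\<bar> + \<bar>b\<bar>)\<^sup>2 / 2" for k
    using abs_ramp_sq_le[of k a b] abs_ramp_sq_le[of k a' b'] by linarith
  have b2: "\<bar>slope k * ramp k a b * x\<bar> \<le> (\<bar>a\<bar> + \<bar>b\<bar>) * \<bar>x\<bar>" for k x
    using mult_right_mono[OF abs_slope_ramp_le, of "\<bar>x\<bar>" k a b] by (simp add: abs_mult)
  have b3: "\<bar>ramp k a b * x\<bar> \<le> (\<bar>a\<bar> + \<bar>b\<bar>) * \<bar>x\<bar>" for k x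
    using mult_right_mono[OF abs_ramp_le, of "\<bar>x\<bar>" k a b] by (simp add: abs_mult)
  have b4: "\<bar>slope k * ramp k a b * (a' - a) + ramp k a b * (b' - b)\<bar>
      \<le> (\<bar>a\<bar> + \<bar>b\<bar>) * \<bar>a' - a\<bar> + (\<bar>a\<bar> + \<bar>b\<bar>) * \<bar>b' - b\<bar>" for k
    using b2[of k "a' - a"] b3[of k "b' - b"] by linarith
  have "wsum ?r = R a b a' b'"
    unfolding R_def obj_def obj_a_def obj_b_def
    by (simp add: wsum_diff[OF b1 b4] wsum_diff[OF abs_ramp_sq_le abs_ramp_sq_le] wsum_add[OF b2 b3]
        wsum_cmult[OF abs_slope_ramp_le] wsum_cmult[OF abs_ramp_le])
  moreover have rb: "0 \<le> ?r k" "?r k \<le> (a' - a)\<^sup>2 + (b' - b)\<^sup>2" for k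
    using ramp_bregman[where k = k and a = a and b = b and a' = a' and b' = b'] by auto
  then have ab: "\<bar>?r k\<bar> \<le> (a' - a)\<^sup>2 + (b' - b)\<^sup>2" for k by (simp only: abs_of_nonneg)
  have "wsum (\<lambda>_. 0) \<le> wsum ?r" by (rule wsum_mono[of _ 0 ?r, OF _ ab rb(1)]) simp
  moreover have "\<bar>wsum ?r\<bar> \<le> 32/31 * ((a' - a)\<^sup>2 + (b' - b)\<^sup>2)" by (rule wsum_abs_le[OF ab])
  moreover have "0 \<le> (a' - a)\<^sup>2 + (b' - b)\<^sup>2" by simp
  ultimately show "0 \<le> R a b a' b'" "R a b a' b' \<le> 2 * ((a' - a)\<^sup>2 + (b' - b)\<^sup>2)"
    by (auto simp: wsum_def)
qed

lemma obj_b_lipschitz: "\<bar>obj_b a b - obj_b a' b'\<bar> \<le> 2 * (\<bar>a - a'\<bar> + \<bar>b - b'\<bar>)"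
proof -
  have "\<bar>wsum (\<lambda>k. ramp k a b - ramp k a' b')\<bar> \<le> 32/31 * (\<bar>a - a'\<bar> + \<bar>b - b'\<bar>)"
    by (rule wsum_abs_le[OF ramp_lipschitz])
  then show ?thesis unfolding obj_b_def wsum_diff[OF abs_ramp_le abs_ramp_le] by argo
qed

lemma obj_a_lipschitz: "\<bar>obj_a a b - obj_a a' b'\<bar> \<le> \<bar>a - a'\<bar> + \<bar>b - b'\<bar>"
proof -
  have "\<bar>slope k * ramp k a b - slope k * ramp k a' b'\<bar> \<le> (\<bar>a - a'\<bar> + \<bar>b - b'\<bar>) / 2" for k
    using abs_slope_mult_le[of k "ramp k a b - ramp k a' b'"] ramp_lipschitz[of k a b a' b']
    unfolding right_diff_distrib by argo
  then have "\<bar>wsum (\<lambda>k. slope k * ramp k a b - slope k * ramp k a' b')\<bar>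
      \<le> 32/31 * ((\<bar>a - a'\<bar> + \<bar>b - b'\<bar>) / 2)"
    by (rule wsum_abs_le)
  then show ?thesis unfolding obj_a_def wsum_diff[OF abs_slope_ramp_le abs_slope_ramp_le] by argo
qed

lemma ramp_le_height:
  assumes "\<bar>a\<bar> \<le> 1" "0 \<le> b"
  shows "ramp k a b \<le> b"
proof -
  have "\<bar>slope k * a\<bar> \<le> (1/32)^k"
    using mult_mono[of "\<bar>slope k\<bar>" "(1/32)^k" "\<bar>a\<bar>" 1] assms by (simp add: abs_mult abs_slope)
  then show ?thesis using assms unfolding ramp_def by (simp add: abs_le_iff)
qed

lemma obj_partials_le:
  assumes "\<bar>a\<bar> \<le> 1" "0 \<le> b"
  shows "obj_b a b \<le> 2 * b" "\<bar>obj_a a b\<bar> \<le> b"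
proof -
  have 1: "\<bar>ramp k a b\<bar> \<le> b" for k
    using ramp_le_height[OF assms, of k] ramp_nonneg[of k a b] by simp
  have 2: "\<bar>slope k * ramp k a b\<bar> \<le> b / 2" for k
    using slope_ramp_le[of k a b] 1[of k] by linarith
  show "obj_b a b \<le> 2 * b"
    using wsum_abs_le[of "\<lambda>k. ramp k a b", OF 1] assms unfolding obj_b_def by linarith
  show "\<bar>obj_a a b\<bar> \<le> b"
    using wsum_abs_le[of "\<lambda>k. slope k * ramp k a b", OF 2] assms unfolding obj_a_def by linarith
qed

text \<open>
  A summand whose threshold \<open>(1/32)^k\<close> is small against the height already contributes this much;
  the bound is uniform above \<open>\<eta>\<close>, which is what drives the height of the iterates to zero.
\<close>

lemma obj_b_lower:
  assumes "\<bar>a\<bar> \<le> 1" "4 * (1/32)^k \<le> \<eta>" "\<eta> \<le> b"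
  shows "(1/32)^k * (\<eta> / 2) \<le> obj_b a b"
proof -
  have "\<bar>slope k * a\<bar> \<le> (1/32)^k"
    using mult_mono[of "\<bar>slope k\<bar>" "(1/32)^k" "\<bar>a\<bar>" 1] assms by (simp add: abs_mult abs_slope)
  then have "\<eta> / 2 \<le> ramp k a b" using assms unfolding ramp_def by (simp add: abs_le_iff)
  then have "(1/32)^k * (\<eta> / 2) \<le> (1/32)^k * ramp k a b" by (intro mult_left_mono) auto
  also have "\<dots> = (\<Sum>j\<in>{k}. (1/32)^j * ramp j a b)" by simp
  also have "\<dots> \<le> obj_b a b" unfolding obj_b_def wsum_def
    by (rule sum_le_suminf[OF summable_weighted[OF abs_ramp_le]]) (auto simp: ramp_nonneg)
  finally show ?thesis .
qed

lemma obj_b_pos: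
  assumes "\<bar>a\<bar> \<le> 1" "0 < b"
  shows "0 < obj_b a b"
proof -
  obtain k where "(1/32::real)^k < b / 4"
    using real_arch_pow_inv[of "b / 4" "1/32"] assms by auto
  then have "(1/32)^k * (b / 2) \<le> obj_b a b" using obj_b_lower[OF assms(1), of k b b] by simp
  moreover have "0 < (1/32::real)^k * (b / 2)" using assms by simp
  ultimately show ?thesis by linarith
qed

text \<open>
  In this band the summands up to \<open>k\<close> vanish, and summand \<open>Suc k\<close> is positive with ramp at least
  \<open>b / 2\<close>. The later ramps are at most \<open>b\<close>, but their coefficients, weight times slope,
  shrink by the factor \<open>(1/32)^2\<close> per index, so together they cannot change the sign.
\<close>

lemma obj_a_sign:
  assumes a: "\<bar>a\<bar> \<le> 1" and b: "3 * (1/32)^Suc k \<le> b" "b \<le> (1/32)^k / 2"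
  shows "0 < (-1)^Suc k * obj_a a b"
proof -
  let ?n = "Suc k"
  let ?q = "\<lambda>j. (1/32::real)^j"
  let ?t = "\<lambda>j. ?q j * (slope j * ramp j a b)"
  have bpos: "0 < b" using b(1) by (smt (verit) zero_less_power zero_less_divide_iff)
  have sa: "\<bar>slope j * a\<bar> \<le> ?q j / 2" for j
    using mult_left_mono[OF a, of "\<bar>slope j\<bar>"] by (simp add: abs_mult abs_slope)
  have zero: "?t j = 0" if "j < ?n" for j
  proof -
    have "?q k \<le> ?q j" using that by (intro power_decreasing) auto
    then have "b - ?q j + slope j * a \<le> 0" using sa[of j] b(2) by argo
    then show ?thesis by (simp add: ramp_def)
  qed
  have sum: "summable ?t" by (rule summable_weighted[OF abs_slope_ramp_le])
  \<comment> \<open>Summand \<open>Suc k\<close> is the leading one; the shifted series is the tail that it has to beat.\<close>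
  have split: "obj_a a b = (\<Sum>j. ?t (j + Suc ?n)) + ?t ?n"
    unfolding obj_a_def wsum_def
    by (subst suminf_split_initial_segment[OF sum, of "Suc ?n"]) (simp add: zero)
  have main: "(-1)^?n * ?t ?n = ?q ?n * (?q ?n / 2) * ramp ?n a b"
    unfolding slope_def by (simp add: power_mult_distrib[symmetric] del: power_Suc)
  have "b / 2 \<le> ramp ?n a b"
    using sa[of ?n] b(1) unfolding ramp_def by (simp add: abs_le_iff)
  then have low: "?q ?n * (?q ?n / 2) * (b / 2) \<le> (-1)^?n * ?t ?n"
    unfolding main by (intro mult_left_mono) auto
  have tl: "norm (?t (j + Suc ?n)) \<le> ?q j * (?q ?n * ?q ?n * b / 64)" for j
  proof -
    have "norm (?t (j + Suc ?n)) = ?q (j + Suc ?n) * (?q (j + Suc ?n) / 2) * ramp (j + Suc ?n) a b"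
      by (simp add: abs_mult abs_slope ramp_nonneg del: power_Suc)
    also have "\<dots> \<le> ?q (j + Suc ?n) * (?q (Suc ?n) / 2) * b"
      using ramp_le_height[OF a, of b "j + Suc ?n"] bpos
      by (intro mult_mono power_decreasing divide_right_mono) (auto simp: ramp_nonneg)
    also have "\<dots> \<le> ?q j * (?q ?n * ?q ?n * b / 64)"
      using bpos by (simp add: power_add)
    finally show ?thesis .
  qed
  have "norm (\<Sum>j. ?t (j + Suc ?n)) \<le> 32/31 * (?q ?n * ?q ?n * b / 64)"
    by (rule order.trans[OF norm_suminf_le[OF tl sums_summable[OF geom_sums]]])
       (simp only: sums_unique[OF geom_sums, symmetric] order.refl)
  then have "\<bar>(-1)^?n * (\<Sum>j. ?t (j + Suc ?n))\<bar> \<le> 32/31 * (?q ?n * ?q ?n * b / 64)"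
    by (simp add: abs_mult)
  moreover have "0 < ?q ?n * ?q ?n * b" using bpos by simp
  moreover have "(-1)^?n * obj_a a b = (-1)^?n * (\<Sum>j. ?t (j + Suc ?n)) + (-1)^?n * ?t ?n"
    unfolding split by (rule distrib_left)
  ultimately show ?thesis using low by argo
qed

section \<open>The optimization problem in the plane\<close>

definition rect :: "(nat \<Rightarrow> real) set" where
  "rect = {p \<in> topspace (Euclidean_space 2). \<bar>p 0\<bar> \<le> 1 \<and> 0 \<le> p 1 \<and> p 1 \<le> 1}"

definition pt :: "real \<Rightarrow> real \<Rightarrow> nat \<Rightarrow> real" where
  "pt a b = (\<lambda>i. if i = 0 then a else if i = 1 then b else 0)"

definition objective :: "(nat \<Rightarrow> real) \<Rightarrow> real" where
  "objective p = obj (p 0) (p 1)"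

definition grad :: "(nat \<Rightarrow> real) \<Rightarrow> nat \<Rightarrow> real" where
  "grad p = pt (obj_a (p 0) (p 1)) (obj_b (p 0) (p 1))"

lemma pt_simps [simp]: "pt a b 0 = a" "pt a b (Suc 0) = b"
  by (simp_all add: pt_def)

lemma pt_in [simp]: "pt a b \<in> topspace (Euclidean_space 2)"
  by (auto simp: topspace_Euclidean_space pt_def)

lemma pt_in_rect [simp]: "pt a b \<in> rect \<longleftrightarrow> \<bar>a\<bar> \<le> 1 \<and> 0 \<le> b \<and> b \<le> 1"
  by (auto simp: rect_def topspace_Euclidean_space pt_def)

lemma euclid_inner_2: "euclid_inner 2 x y = x 0 * y 0 + x 1 * y 1"
  by (simp add: euclid_inner_def numeral_2_eq_2)

lemma euclid_norm_2: "euclid_norm 2 x = sqrt ((x 0)\<^sup>2 + (x 1)\<^sup>2)"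
  by (simp add: euclid_norm_def L2_set_def numeral_2_eq_2)

lemma euclid_norm_2_sq: "(euclid_norm 2 x)\<^sup>2 = (x 0)\<^sup>2 + (x 1)\<^sup>2"
  by (simp add: euclid_norm_2)

lemma convex_rect: "convex rect"
proof (rule convexI)
  fix p q :: "nat \<Rightarrow> real" and u w :: real
  assume pq: "p \<in> rect" "q \<in> rect" and uw: "0 \<le> u" "0 \<le> w" "u + w = 1"
  have pq': "\<bar>p 0\<bar> \<le> 1" "p 1 \<le> 1" "\<bar>q 0\<bar> \<le> 1" "q 1 \<le> 1" using pq by (auto simp: rect_def)
  have "\<bar>u * p 0 + w * q 0\<bar> \<le> \<bar>u * p 0\<bar> + \<bar>w * q 0\<bar>" by (rule abs_triangle_ineq)
  also have "\<dots> = u * \<bar>p 0\<bar> + w * \<bar>q 0\<bar>" using uw by (simp add: abs_mult)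
  also have "\<dots> \<le> u * 1 + w * 1" using pq' uw by (intro add_mono mult_left_mono)
  finally have "\<bar>u * p 0 + w * q 0\<bar> \<le> u * 1 + w * 1" .
  moreover have "u * p 1 + w * q 1 \<le> u * 1 + w * 1"
    using pq' uw by (intro add_mono mult_left_mono)
  ultimately show "u *\<^sub>R p + w *\<^sub>R q \<in> rect"
    using pq uw by (auto simp: rect_def topspace_Euclidean_space scaleR_fun_def)
qed

lemma compactin_rect: "compactin (Euclidean_space 2) rect"
proof -
  have eq: "rect = PiE UNIV (\<lambda>i. if i = 0 then {-1..1} else if i = 1 then {0..1} else {0})" (is "_ = ?P")
    unfolding rect_def topspace_Euclidean_space
  proof (intro set_eqI iffI)
    fix p :: "nat \<Rightarrow> real" assume "p \<in> {p \<in> {x. \<forall>i\<ge>2. x i = 0}. \<bar>p 0\<bar> \<le> 1 \<and> 0 \<le> p 1 \<and> (p 1::real) \<le> 1}"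
    then show "p \<in> ?P" by (auto simp: abs_le_iff)
  next
    fix p :: "nat \<Rightarrow> real" assume p: "p \<in> ?P"
    have mem: "p i \<in> (if i = 0 then {-1..1} else if i = 1 then {0..1} else {0})" for i
      using PiE_mem[OF p, of i] by simp
    have "p i = 0" if "2 \<le> i" for i using mem[of i] that by simp
    with mem[of 0] mem[of 1] show "p \<in> {p \<in> {x. \<forall>i\<ge>2. x i = 0}. \<bar>p 0\<bar> \<le> 1 \<and> 0 \<le> p 1 \<and> p 1 \<le> 1}"
      by (auto simp: abs_le_iff)
  qed
  have "compactin (powertop_real UNIV) rect"
    unfolding eq by (subst compactin_PiE) auto
  moreover have "rect \<subseteq> {x. \<forall>i\<ge>2. x i = 0}" by (auto simp: rect_def topspace_Euclidean_space)
  ultimately show ?thesis by (simp add: Euclidean_space_def compactin_subtopology)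
qed

lemma convex_topspace_Euclidean_space: "convex (topspace (Euclidean_space n))"
  by (rule convexI) (auto simp: topspace_Euclidean_space scaleR_fun_def)

lemma objective_above_tangent:
  "objective p + (grad p 0 * (q 0 - p 0) + grad p 1 * (q 1 - p 1)) \<le> objective q"
  using obj_bregman(1)[where a = "p 0" and b = "p 1" and a' = "q 0" and b' = "q 1"]
  by (simp add: objective_def grad_def)

lemma convex_objective: "convex_on (topspace (Euclidean_space 2)) objective"
proof (rule convex_onI[OF _ convex_topspace_Euclidean_space])
  fix t :: real and p q :: "nat \<Rightarrow> real"
  assume t: "0 < t" "t < 1"
  let ?m = "(1 - t) *\<^sub>R p + t *\<^sub>R q"
  have "(1 - t) * (objective ?m + (grad ?m 0 * (p 0 - ?m 0) + grad ?m 1 * (p 1 - ?m 1)))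
      + t * (objective ?m + (grad ?m 0 * (q 0 - ?m 0) + grad ?m 1 * (q 1 - ?m 1)))
      \<le> (1 - t) * objective p + t * objective q"
    using t by (intro add_mono mult_left_mono objective_above_tangent) auto
  moreover have "(1 - t) * (objective ?m + (grad ?m 0 * (p 0 - ?m 0) + grad ?m 1 * (p 1 - ?m 1)))
      + t * (objective ?m + (grad ?m 0 * (q 0 - ?m 0) + grad ?m 1 * (q 1 - ?m 1))) = objective ?m"
  proof -
    have "(1 - t) * (F + (g * (x - ((1-t)*x + t*y)) + h * (u - ((1-t)*u + t*w))))
      + t * (F + (g * (y - ((1-t)*x + t*y)) + h * (w - ((1-t)*u + t*w)))) = F"
      for F g h x y u w :: real by (simp add: algebra_simps)
    from this[of "objective ?m" "grad ?m 0" "p 0" "q 0" "grad ?m 1" "p 1" "q 1"]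
    show ?thesis by (simp add: scaleR_fun_def)
  qed
  ultimately show "objective ?m \<le> (1 - t) * objective p + t * objective q" by simp
qed

lemma continuous_map_coordinate: "continuous_map (Euclidean_space n) euclideanreal (\<lambda>p. p i)"
  unfolding Euclidean_space_def
  by (intro continuous_map_from_subtopology continuous_map_product_projection) simp

lemma has_gradient_objective:
  assumes "p \<in> topspace (Euclidean_space 2)"
  shows "has_gradient 2 objective (grad p) p"
  unfolding has_gradient_def
proof (intro conjI)
  show "((\<lambda>q. (objective q - objective p - euclid_inner 2 (grad p) (q - p)) / euclid_norm 2 (q - p)) \<longlongrightarrow> 0)
     (atin (Euclidean_space 2) p)"
  proof (rule Lim_null_comparison)
    show "\<forall>\<^sub>F q in atin (Euclidean_space 2) p.
        norm ((objective q - objective p - euclid_inner 2 (grad p) (q - p)) / euclid_norm 2 (q - p))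
          \<le> 2 * euclid_norm 2 (q - p)"
    proof (rule always_eventually, rule allI)
      fix q
      let ?N = "euclid_norm 2 (q - p)"
      have "\<bar>objective q - objective p - euclid_inner 2 (grad p) (q - p)\<bar> \<le> 2 * ?N\<^sup>2"
        using obj_bregman[where a = "p 0" and b = "p 1" and a' = "q 0" and b' = "q 1"]
        by (simp add: euclid_norm_2_sq euclid_inner_2 objective_def grad_def)
      moreover have "0 \<le> ?N" by (simp add: euclid_norm_2)
      ultimately show "norm ((objective q - objective p - euclid_inner 2 (grad p) (q - p)) / ?N) \<le> 2 * ?N"
        by (cases "?N = 0") (auto simp: power2_eq_square divide_le_eq)
    qed
    have c: "((\<lambda>q. q i) \<longlongrightarrow> p i) (atin (Euclidean_space 2) p)" for i
      using continuous_map_coordinate[of 2 i] assms by (auto simp: continuous_map_atin)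
    have "((\<lambda>q. 2 * sqrt ((q 0 - p 0)\<^sup>2 + (q 1 - p 1)\<^sup>2)) \<longlongrightarrow>
        2 * sqrt ((p 0 - p 0)\<^sup>2 + (p 1 - p 1)\<^sup>2)) (atin (Euclidean_space 2) p)"
      by (intro tendsto_intros c)
    then show "((\<lambda>q. 2 * euclid_norm 2 (q - p)) \<longlongrightarrow> 0) (atin (Euclidean_space 2) p)"
      by (simp add: euclid_norm_2)
  qed
qed (use assms in \<open>simp_all add: grad_def\<close>)

lemma lipschitz_objective: "lipschitz_gradient_on 2 16 (topspace (Euclidean_space 2)) objective grad"
  unfolding lipschitz_gradient_on_def
proof (intro conjI ballI has_gradient_objective)
  fix p q :: "nat \<Rightarrow> real"
  let ?N = "euclid_norm 2 (p - q)"
  have "\<bar>p 0 - q 0\<bar> \<le> ?N" "\<bar>p 1 - q 1\<bar> \<le> ?N"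
    by (auto simp: euclid_norm_2 intro: real_sqrt_ge_abs1 real_sqrt_ge_abs2)
  moreover have "euclid_norm 2 (grad p - grad q) \<le> \<bar>(grad p - grad q) 0\<bar> + \<bar>(grad p - grad q) 1\<bar>"
    unfolding euclid_norm_2 by (rule sqrt_sum_squares_le_sum_abs)
  ultimately show "euclid_norm 2 (grad p - grad q) \<le> 16 * ?N"
    using obj_a_lipschitz[of "p 0" "p 1" "q 0" "q 1"] obj_b_lipschitz[of "p 0" "p 1" "q 0" "q 1"]
    by (simp add: grad_def[of p] grad_def[of q]) argo
qed

section \<open>The iterates\<close>

context
  fixes x v :: "nat \<Rightarrow> nat \<Rightarrow> real" and \<gamma> :: "nat \<Rightarrow> real"
  assumes run: "frank_wolfe 2 rect grad (pt 0 1) x v \<gamma>"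
    and loop: "closed_loop 2 16 grad x v \<gamma>"
begin

lemma vertex_in: "v t \<in> rect" and step01: "0 \<le> \<gamma> t" "\<gamma> t \<le> 1"
  and step: "x (Suc t) i = (1 - \<gamma> t) * x t i + \<gamma> t * v t i"
  and start: "x 0 = pt 0 1"
  using run by (auto simp: frank_wolfe_def is_arg_min_def scaleR_fun_def)

lemma vertex_opt:
  assumes "w \<in> rect"
  shows "v t 0 * grad (x t) 0 + v t 1 * grad (x t) 1 \<le> w 0 * grad (x t) 0 + w 1 * grad (x t) 1"
  using run assms by (auto simp: frank_wolfe_def is_arg_min_def euclid_inner_2 not_less)

lemma iterate_in: "x t \<in> rect"
proof (induction t)
  case 0
  then show ?case by (simp add: start)
next
  case (Suc t)
  have "x (Suc t) = (1 - \<gamma> t) *\<^sub>R x t + \<gamma> t *\<^sub>R v t" using run by (simp add: frank_wolfe_def)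
  also have "\<dots> \<in> rect"
    by (rule convexD[OF convex_rect Suc vertex_in]) (use step01[of t] in simp_all)
  finally show ?case .
qed

lemma abs_x: "\<bar>x t 0\<bar> \<le> 1" and abs_v: "\<bar>v t 0\<bar> \<le> 1"
  using iterate_in[of t] vertex_in[of t] by (simp_all add: rect_def)

text \<open>
  On the rectangle the oracle decouples into the two coordinates, so a positive vertical derivative
  forces the bottom edge. The upper bound on the step uses that both partial derivatives are
  \<open>O(b)\<close>, which makes the Frank-Wolfe gap at most \<open>3\<close> times the squared distance to the vertex. The
  lower bound keeps only the vertical part of the gap, the horizontal part being
  nonnegative by optimality of the vertex; \<open>80 = 16 \<cdot> 5\<close>, where \<open>5\<close> is the squared diameter of the
  rectangle.
\<close>

lemma step_from_positive_height:
  assumes "0 < x t 1"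
  shows "v t 1 = 0" "\<gamma> t \<le> 1/4" "x t 1 * obj_b (x t 0) (x t 1) / 80 \<le> \<gamma> t"
proof -
  let ?a = "x t 0" and ?b = "x t 1"
  have gp: "0 < obj_b ?a ?b" by (rule obj_b_pos[OF abs_x assms])
  have "pt (v t 0) 0 \<in> rect" using abs_v[of t] by simp
  from vertex_opt[OF this, of t] have "v t 1 * obj_b ?a ?b \<le> 0" by (simp add: grad_def)
  moreover have "0 \<le> v t 1" using vertex_in[of t] by (simp add: rect_def)
  ultimately show v1: "v t 1 = 0" using gp by (simp add: mult_le_0_iff)
  define d where "d = ?a - v t 0"
  define S where "S = d * obj_a ?a ?b + ?b * obj_b ?a ?b"
  define Q where "Q = d\<^sup>2 + ?b\<^sup>2"
  have "pt ?a 0 \<in> rect" using abs_x[of t] by simp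
  from vertex_opt[OF this, of t] have dn: "0 \<le> d * obj_a ?a ?b"
    by (simp add: grad_def v1[simplified] d_def algebra_simps)
  have b1: "?b \<le> 1" using iterate_in[of t] by (simp add: rect_def)
  have Qpos: "0 < Q" using assms by (simp add: Q_def add_nonneg_pos)
  have "\<bar>d\<bar> \<le> 2" using abs_x[of t] abs_v[of t] unfolding d_def by linarith
  then have "d\<^sup>2 \<le> 4" using power_mono[of "\<bar>d\<bar>" 2 2] by simp
  moreover have "?b\<^sup>2 \<le> 1" using b1 assms by (simp add: power_le_one)
  ultimately have Q5: "Q \<le> 5" by (simp add: Q_def)
  \<comment> \<open>The vertex lies on the bottom edge and the iterate above it, so the quotient is defined.\<close>
  have "v t \<noteq> x t" using v1 assms by auto
  then have gam: "\<gamma> t = min (S / (16 * Q)) 1"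
    using loop by (simp add: closed_loop_def euclid_inner_2 euclid_norm_2_sq grad_def v1[simplified] S_def Q_def d_def)
  have "d * obj_a ?a ?b \<le> \<bar>d\<bar> * ?b"
    using obj_partials_le(2)[OF abs_x, of ?b t] assms
    by (metis abs_ge_self abs_ge_zero abs_mult less_eq_real_def mult_left_mono order.trans)
  moreover have "\<bar>d\<bar> * ?b \<le> Q"
    using sum_squares_bound[of "\<bar>d\<bar>" ?b] Qpos by (simp add: Q_def)
  moreover have "?b * obj_b ?a ?b \<le> ?b * (2 * ?b)"
    using obj_partials_le(1)[OF abs_x, of ?b t] assms by (intro mult_left_mono) auto
  moreover have "?b * (2 * ?b) \<le> 2 * Q" by (simp add: Q_def power2_eq_square)
  ultimately have "S \<le> 3 * Q" unfolding S_def by linarith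
  then have "S / (16 * Q) \<le> 1/4" using Qpos by (simp add: divide_le_eq)
  then have gS: "\<gamma> t = S / (16 * Q)" and "\<gamma> t \<le> 1/4" by (simp_all add: gam)
  then show "\<gamma> t \<le> 1/4" by simp
  have "?b * obj_b ?a ?b / 80 \<le> S / 80" using dn by (simp add: S_def)
  also have "\<dots> \<le> S / (16 * Q)"
    using Q5 Qpos dn gp assms by (intro divide_left_mono) (auto simp: S_def)
  finally show "?b * obj_b ?a ?b / 80 \<le> \<gamma> t" by (simp add: gS)
qed

lemma height_pos: "0 < x t 1"
proof (induction t)
  case 0
  then show ?case by (simp add: start)
next
  case (Suc t)
  then show ?case using step_from_positive_height[OF Suc] by (simp add: step)
qed

lemmas vertex_height = step_from_positive_height(1)[OF height_pos]
  and step_le = step_from_positive_height(2)[OF height_pos]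
  and step_ge = step_from_positive_height(3)[OF height_pos]

lemma height_Suc: "x (Suc t) 1 = (1 - \<gamma> t) * x t 1"
  by (simp only: step vertex_height mult_zero_right add_0_right)

lemma height_antimono: "s \<le> t \<Longrightarrow> x t 1 \<le> x s 1"
proof (rule lift_Suc_antimono_le[of "\<lambda>t. x t 1"])
  show "x (Suc n) 1 \<le> x n 1" for n
    unfolding height_Suc using step01[of n] height_pos[of n] by (simp add: mult_left_le_one_le)
qed

text \<open>
  A height bounded below would bound the steps below, and then the height would decay
  geometrically.
\<close>

lemma height_small:
  assumes "0 < \<eta>"
  shows "\<exists>t. x t 1 < \<eta>"
proof (rule ccontr)
  assume "\<not> ?thesis"
  then have ge: "\<eta> \<le> x t 1" for t by (simp add: not_less)
  obtain k where "(1/32::real)^k < \<eta> / 4"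
    using real_arch_pow_inv[of "\<eta> / 4" "1/32"] assms by auto
  then have k: "4 * (1/32)^k \<le> \<eta>" by simp
  define c where "c = \<eta> * ((1/32)^k * (\<eta> / 2)) / 80"
  have cpos: "0 < c" using assms by (simp add: c_def)
  have c: "c \<le> \<gamma> t" for t
  proof -
    have "\<eta> * ((1/32)^k * (\<eta> / 2)) \<le> x t 1 * obj_b (x t 0) (x t 1)"
      using obj_b_lower[OF abs_x k ge] ge[of t] assms by (intro mult_mono) auto
    then show ?thesis using step_ge[of t] unfolding c_def by linarith
  qed
  have c1: "c \<le> 1" using c[of 0] step01[of 0] by linarith
  have pw: "x t 1 \<le> (1 - c)^t" for t
  proof (induction t)
    case 0
    then show ?case by (simp add: start)
  next
    case (Suc t)
    have "(1 - \<gamma> t) * x t 1 \<le> (1 - c) * (1 - c)^t"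
      using c[of t] c1 step01[of t] height_pos[of t] Suc by (intro mult_mono) auto
    then show ?case unfolding height_Suc by simp
  qed
  obtain n where "(1 - c)^n < \<eta>" using real_arch_pow_inv[of \<eta> "1 - c"] assms cpos by auto
  then show False using pw[of n] ge[of n] by linarith
qed

lemma vertex_in_band:
  assumes "3 * (1/32)^Suc k \<le> x t 1" "x t 1 \<le> (1/32)^k / 2"
  shows "v t 0 = - ((-1)^Suc k)"
proof -
  let ?s = "(-1)^Suc k :: real"
  let ?A = "obj_a (x t 0) (x t 1)"
  have s: "?s = 1 \<or> ?s = -1" by (simp add: minus_one_power_iff)
  have "0 < ?s * ?A" by (rule obj_a_sign[OF abs_x assms])
  moreover have "pt (- ?s) 0 \<in> rect" by (simp add: power_abs)
  from vertex_opt[OF this, of t] have "v t 0 * ?A \<le> - ?s * ?A"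
    by (simp add: vertex_height[simplified] grad_def)
  ultimately have "?s = 1 \<and> v t 0 * ?A \<le> - 1 * ?A \<and> 0 < ?A \<or> ?s = - 1 \<and> v t 0 * ?A \<le> 1 * ?A \<and> ?A < 0"
    using s by (elim disjE) (simp_all only: mult_1 mult_minus1 minus_minus, auto)
  then have "?s = 1 \<and> v t 0 \<le> - 1 \<or> ?s = - 1 \<and> 1 \<le> v t 0"
    by (metis mult_le_cancel_right_neg mult_le_cancel_right_pos)
  then show ?thesis using abs_v[of t] by linarith
qed


lemma height_ge: "(3/4)^t \<le> x t 1"
proof (induction t)
  case 0
  then show ?case by (simp add: start)
next
  case (Suc t)
  have "3/4 * (3/4)^t \<le> (1 - \<gamma> t) * x t 1"
    using step_le[of t] Suc by (intro mult_mono) auto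
  then show ?case unfolding height_Suc by simp
qed

text \<open>
  Let \<open>s\<close> be the first time at or below the top \<open>q / 2\<close> of the band, and \<open>T\<close> the first time below
  its bottom \<open>3 q / 32\<close>, where \<open>q = (1/32)^k\<close>. Steps of size at most \<open>1/4\<close> keep the height at time
  \<open>s\<close> at least \<open>3 q / 8\<close>, so from \<open>s\<close> to \<open>T\<close> the height, and with it the distance to the corner,
  shrinks at least by the factor \<open>4\<close>; that distance was at most \<open>2\<close>.
\<close>

lemma near_vertex_of_band: "\<exists>t \<ge> k. \<bar>x t 0 + (-1)^Suc k\<bar> \<le> 1/2"
proof -
  define q where "q = (1/32::real)^k"
  define e where "e = (-1::real)^Suc k"
  define s where "s = (LEAST t. x t 1 \<le> q / 2)"
  define T where "T = (LEAST t. x t 1 < 3 * q / 32)"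
  have q: "0 < q" "q \<le> 1" by (simp_all add: q_def pow_le_1)
  obtain t0 where t0: "x t0 1 < 3 * q / 32" using height_small[of "3 * q / 32"] q by auto
  have xT: "x T 1 < 3 * q / 32" unfolding T_def by (rule LeastI[of "\<lambda>t. x t 1 < 3 * q / 32", OF t0])
  have before_T: "3 * q / 32 \<le> x t 1" if "t < T" for t
    using not_less_Least[OF that[unfolded T_def]] by simp
  have xs: "x s 1 \<le> q / 2"
    unfolding s_def by (rule LeastI[of "\<lambda>t. x t 1 \<le> q / 2" t0]) (use t0 q in simp)
  then have "s \<noteq> 0" using q start by (intro notI) simp
  then obtain r where r: "s = Suc r" using not0_implies_Suc by blast
  then have "q / 2 < x r 1" using not_less_Least[of r "\<lambda>t. x t 1 \<le> q / 2"] s_def by simp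
  then have "3/4 * (q / 2) \<le> (1 - \<gamma> r) * x r 1" using step_le[of r] q by (intro mult_mono) auto
  then have xs_ge: "3 * q / 8 \<le> x s 1" unfolding r height_Suc by simp
  have "s \<le> T"
  proof (rule ccontr)
    assume "\<not> s \<le> T"
    then show False using height_antimono[of T s] xT xs_ge q by simp
  qed
  \<comment> \<open>The height and the distance to the corner both shrink by \<open>1 - \<gamma>\<close> in each step, so their ratio is preserved.\<close>
  have ratio: "(x (s + n) 0 + e) * x s 1 = (x s 0 + e) * x (s + n) 1" if "s + n \<le> T" for n
    using that
  proof (induction n)
    case 0
    then show ?case by simp
  next
    case (Suc n)
    have "v (s + n) 0 = - e" unfolding e_def
    proof (rule vertex_in_band)
      show "3 * (1/32)^Suc k \<le> x (s + n) 1" using before_T[of "s + n"] Suc.prems by (simp add: q_def)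
      show "x (s + n) 1 \<le> (1/32)^k / 2" using height_antimono[of s "s + n"] xs by (simp add: q_def)
    qed
    then have "x (Suc (s + n)) 0 + e = (1 - \<gamma> (s + n)) * (x (s + n) 0 + e)"
      by (simp add: step algebra_simps)
    then have "(x (Suc (s + n)) 0 + e) * x s 1 = (1 - \<gamma> (s + n)) * ((x (s + n) 0 + e) * x s 1)"
      by (simp only: mult.assoc)
    also have "(x (s + n) 0 + e) * x s 1 = (x s 0 + e) * x (s + n) 1" using Suc by simp
    also have "(1 - \<gamma> (s + n)) * ((x s 0 + e) * x (s + n) 1) = (x s 0 + e) * x (Suc (s + n)) 1"
      unfolding height_Suc by (simp only: mult.left_commute)
    finally show ?case by simp
  qed
  have "\<bar>e\<bar> = 1" by (simp add: e_def power_abs)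
  then have "\<bar>x s 0 + e\<bar> \<le> 2" using abs_x[of s] by linarith
  have "\<bar>x T 0 + e\<bar> * (3 * q / 8) \<le> \<bar>x T 0 + e\<bar> * x s 1"
    using xs_ge by (intro mult_left_mono) auto
  also have "\<dots> = \<bar>(x T 0 + e) * x s 1\<bar>" using height_pos[of s] by (simp add: abs_mult)
  also have "(x T 0 + e) * x s 1 = (x s 0 + e) * x T 1" using ratio[of "T - s"] \<open>s \<le> T\<close> by simp
  also have "\<bar>(x s 0 + e) * x T 1\<bar> = \<bar>x s 0 + e\<bar> * x T 1" using height_pos[of T] by (simp add: abs_mult)
  also have "\<dots> \<le> 2 * (3 * q / 32)"
    using \<open>\<bar>x s 0 + e\<bar> \<le> 2\<close> xT height_pos[of T] by (intro mult_mono) auto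
  finally have "\<bar>x T 0 + e\<bar> * (3 * q / 8) \<le> (1/2) * (3 * q / 8)" by simp
  then have close: "\<bar>x T 0 + e\<bar> \<le> 1/2" using q by (subst (asm) mult_le_cancel_right) simp
  \<comment> \<open>The height decreases no faster than \<open>(3/4)^t\<close>, so deep bands are reached late.\<close>
  have "k \<le> T"
  proof (rule ccontr)
    assume "\<not> k \<le> T"
    then have "x k 1 \<le> x T 1" by (intro height_antimono) simp
    moreover have "q \<le> (3/4)^k" unfolding q_def by (intro power_mono) auto
    ultimately show False using height_ge[of k] xT q by linarith
  qed
  then show ?thesis using close unfolding e_def by blast
qed

lemma diverges: "\<not> (\<exists>l. limitin (Euclidean_space 2) x l sequentially)"
proof
  assume "\<exists>l. limitin (Euclidean_space 2) x l sequentially"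
  then obtain l where "limitin (Euclidean_space 2) x l sequentially" ..
  then have "limitin euclideanreal ((\<lambda>p. p 0) \<circ> x) (l 0) sequentially"
    by (rule continuous_map_limit[OF continuous_map_coordinate])
  then have "(\<lambda>t. x t 0) \<longlonglongrightarrow> l 0" by (simp add: o_def)
  then obtain N where N: "\<bar>x t 0 - l 0\<bar> < 1/4" if "t \<ge> N" for t
    using LIMSEQ_D[of "\<lambda>t. x t 0" "l 0" "1/4"] by auto
  obtain t where t: "t \<ge> 2 * N" "\<bar>x t 0 - 1\<bar> \<le> 1/2"
    using near_vertex_of_band[of "2 * N"] by auto
  obtain t' where t': "t' \<ge> Suc (2 * N)" "\<bar>x t' 0 + 1\<bar> \<le> 1/2"
    using near_vertex_of_band[of "Suc (2 * N)"] by auto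
  show False using N[of t] N[of t'] t t' by linarith
qed

end

theorem mainTheorem3:
  shows "\<exists>(n::nat) (L::real) (C::(nat \<Rightarrow> real) set) (D::(nat \<Rightarrow> real) set)
           (f::(nat \<Rightarrow> real) \<Rightarrow> real) (f'::(nat \<Rightarrow> real) \<Rightarrow> nat \<Rightarrow> real) (x0::nat \<Rightarrow> real).
     L > 0 \<and>
     C \<noteq> {} \<and> compactin (Euclidean_space n) C \<and> convex C \<and>
     openin (Euclidean_space n) D \<and> convex D \<and> C \<subseteq> D \<and>
     convex_on D f \<and> lipschitz_gradient_on n L D f f' \<and>
     x0 \<in> C \<and>
     (\<forall>x v \<gamma>. frank_wolfe n C f' x0 x v \<gamma> \<and> closed_loop n L f' x v \<gamma> \<longrightarrow>
        \<not> (\<exists>l. limitin (Euclidean_space n) x l sequentially))"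
proof -
  have start: "pt 0 1 \<in> rect" by simp
  show ?thesis
  proof (rule exI[of _ 2], rule exI[of _ 16], rule exI[of _ rect],
      rule exI[of _ "topspace (Euclidean_space 2)"], rule exI[of _ objective], rule exI[of _ grad],
      rule exI[of _ "pt 0 1"], intro conjI allI impI)
    show "rect \<noteq> {}" using start by blast
    show "rect \<subseteq> topspace (Euclidean_space 2)" by (auto simp: rect_def)
    show "\<not> (\<exists>l. limitin (Euclidean_space 2) x l sequentially)"
      if "frank_wolfe 2 rect grad (pt 0 1) x v \<gamma> \<and> closed_loop 2 16 grad x v \<gamma>" for x v \<gamma>
      using that by (intro diverges) auto
  qed (simp_all add: start compactin_rect convex_rect convex_topspace_Euclidean_space convex_objective lipschitz_objective)
qed

end
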